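(* Let $C,\tilde C\in\mathbb{R}^{m\times m}$ be two network matrices with nonnegative entries that have the same in-degree sequence $d_1^{(\mathrm{in})}\ge\dots\ge d_m^{(\mathrm{in})}$ and different out-degree sequences $(c_1^{(\mathrm{out})},\dots,c_m^{(\mathrm{out})})$ and $(\tilde c_1^{(\mathrm{out})},\dots,\tilde c_m^{(\mathrm{out})})$, respectively. If the imbalance sequence of $C$ majorizes the imbalance sequence of $\tilde C$, then $$\mathbf{1}^TC^2\mathbf{1}\le\mathbf{1}^T\tilde C^2\mathbf{1}.$$
   Context: For a matrix $C\in\mathbb{R}^{m\times m}$ viewed as a weighted directed network ($C_{ij}$ is the weight of the edge from $j$ to $i$), the in-degree and out-degree of node $i$ are $d_i^{(\mathrm{in})}=\sum_{j=1}^mC_{ij}$ and $d_i^{(\mathrm{out})}=\sum_{j=1}^mC_{ji}$. The imbalance sequence is $(d_1^{(\mathrm{in})}-d_1^{(\mathrm{out})},\dots,d_m^{(\mathrm{in})}-d_m^{(\mathrm{out})})$. In this statement, a sequence $(a_1,\dots,a_m)$ is said to majorize $(b_1,\dots,b_m)$ if and only if for every $1\le i\le m$ we have $\sum_{j=1}^ia_j\ge\sum_{j=1}^ib_j$ (no reordering of the sequences). $\mathbf{1}$ is the all-ones vector. *)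

theory Defs
  imports "Jordan_Normal_Form.Matrix"
begin

(* The node numbers 1..m become 0..m-1. The entry C $$ (i, j) is the weight of the
   edge from node j to node i, so row sums are in-degrees and column sums are
   out-degrees. Intended for square matrices. *)

definition in_degrees :: "real mat \<Rightarrow> real vec" where
  "in_degrees C = vec (dim_row C) (\<lambda>i. \<Sum>j<dim_row C. C $$ (i, j))"

definition out_degrees :: "real mat \<Rightarrow> real vec" where
  "out_degrees C = vec (dim_row C) (\<lambda>i. \<Sum>j<dim_row C. C $$ (j, i))"

definition imbalances :: "real mat \<Rightarrow> real vec" where
  "imbalances C = in_degrees C - out_degrees C"

(* Unlike in the usual notion of majorization, the sequences are not sorted first, and
   equality of the total sums is not required. *)
definition majorizes :: "real vec \<Rightarrow> real vec \<Rightarrow> bool" where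
  "majorizes a b \<longleftrightarrow> dim_vec a = dim_vec b \<and>
     (\<forall>i<dim_vec a. (\<Sum>j\<le>i. a $ j) \<ge> (\<Sum>j\<le>i. b $ j))"

definition all_ones :: "nat \<Rightarrow> real vec" where
  "all_ones m = vec m (\<lambda>_. 1)"

end

theory Submission
  imports Defs
begin

text \<open>Expanding the matrix product gives \<open>1\<^sup>T C\<^sup>2 1 = \<Sum>k. d\<^sub>k\<^sup>i\<^sup>n d\<^sub>k\<^sup>o\<^sup>u\<^sup>t\<close>.
  With equal in-degrees, majorization of the imbalances says that every prefix sum of the
  out-degrees of \<open>C'\<close> is at least that of \<open>C\<close>. Since the in-degrees decrease and are
  nonnegative, summation by parts gives the inequality.\<close>

text \<open>Summation by parts, arranged as an induction. Keeping the last weight \<open>d n\<close>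
  in the lower bound makes the claim strong enough to extend by one term.\<close>

lemma antimono_weighted_sum_ge:
  fixes d e :: "nat \<Rightarrow> 'a :: linordered_idom"
  assumes "\<And>i. i < n \<Longrightarrow> d (Suc i) \<le> d i"
    and "\<And>i. i \<le> n \<Longrightarrow> 0 \<le> (\<Sum>k\<le>i. e k)"
  shows "d n * (\<Sum>k\<le>n. e k) \<le> (\<Sum>k\<le>n. d k * e k)"
  using assms
proof (induction n)
  case 0
  then show ?case by simp
next
  case (Suc n)
  \<comment> \<open>Lowering the weight is harmless against a nonnegative prefix sum; adding
    \<open>d (Suc n) * e (Suc n)\<close> to both ends then closes the induction.\<close>
  have "d (Suc n) * (\<Sum>k\<le>n. e k) \<le> d n * (\<Sum>k\<le>n. e k)"
    using Suc.prems by (intro mult_right_mono) auto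
  also have "\<dots> \<le> (\<Sum>k\<le>n. d k * e k)"
    using Suc by simp
  finally show ?case
    by (simp add: algebra_simps)
qed

lemma antimono_weighted_sum_nonneg:
  fixes d e :: "nat \<Rightarrow> 'a :: linordered_idom"
  assumes "\<And>i. Suc i < m \<Longrightarrow> d (Suc i) \<le> d i"
    and "\<And>i. i < m \<Longrightarrow> 0 \<le> d i"
    and "\<And>i. i < m \<Longrightarrow> 0 \<le> (\<Sum>k\<le>i. e k)"
  shows "0 \<le> (\<Sum>k<m. d k * e k)"
proof (cases m)
  case (Suc n)
  have "0 \<le> d n * (\<Sum>k\<le>n. e k)"
    using assms Suc by simp
  also have "\<dots> \<le> (\<Sum>k\<le>n. d k * e k)"
    using assms Suc by (intro antimono_weighted_sum_ge) auto
  finally show ?thesis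
    by (simp add: Suc lessThan_Suc_atMost)
qed simp

text \<open>The left side is the total weight of two-step walks from \<open>j\<close> via
  \<open>k\<close> to \<open>i\<close>. For a fixed middle node \<open>k\<close> the sum factors
  into column sum times row sum.\<close>

lemma all_ones_square_sum:
  assumes "C \<in> carrier_mat m m"
  shows "all_ones m \<bullet> ((C ^\<^sub>m 2) *\<^sub>v all_ones m) =
    (\<Sum>k<m. in_degrees C $ k * out_degrees C $ k)"
proof -
  have "all_ones m \<bullet> ((C ^\<^sub>m 2) *\<^sub>v all_ones m) = (\<Sum>i<m. \<Sum>k<m. \<Sum>j<m. C $$ (i, k) * C $$ (k, j))"
    using assms
    by (simp add: numeral_2_eq_2 all_ones_def scalar_prod_def atLeast0LessThan sum_distrib_left)
  also have "\<dots> = (\<Sum>k<m. \<Sum>i<m. \<Sum>j<m. C $$ (i, k) * C $$ (k, j))"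
    by (rule sum.swap)
  also have "\<dots> = (\<Sum>k<m. in_degrees C $ k * out_degrees C $ k)"
    using assms by (simp add: in_degrees_def out_degrees_def sum_product mult.commute)
  finally show ?thesis .
qed

theorem proposition3:
  fixes C C' :: "real mat" and m :: nat
  assumes "C \<in> carrier_mat m m" and "C' \<in> carrier_mat m m"
    and "\<forall>i<m. \<forall>j<m. C $$ (i, j) \<ge> 0"
    and "\<forall>i<m. \<forall>j<m. C' $$ (i, j) \<ge> 0"
    and "in_degrees C = in_degrees C'"
    and "\<forall>i j. i \<le> j \<and> j < m \<longrightarrow> in_degrees C $ i \<ge> in_degrees C $ j"
    and "out_degrees C \<noteq> out_degrees C'"
    and "majorizes (imbalances C) (imbalances C')"
  shows "all_ones m \<bullet> ((C ^\<^sub>m 2) *\<^sub>v all_ones m) \<le> all_ones m \<bullet> ((C' ^\<^sub>m 2) *\<^sub>v all_ones m)"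
proof -
  let ?d = "\<lambda>k. in_degrees C $ k"
  let ?e = "\<lambda>k. out_degrees C' $ k - out_degrees C $ k"
  have dims: "dim_row C = m" "dim_row C' = m"
    using assms(1,2) by auto
  have d_nonneg: "0 \<le> ?d i" if "i < m" for i
    using assms(3) that by (auto simp: in_degrees_def dims intro: sum_nonneg)
  have prefix: "0 \<le> (\<Sum>k\<le>i. ?e k)" if "i < m" for i
  proof -
    have "(\<Sum>k\<le>i. imbalances C' $ k) \<le> (\<Sum>k\<le>i. imbalances C $ k)"
      using assms(8) that by (simp add: majorizes_def imbalances_def out_degrees_def dims)
    \<comment> \<open>Used for both \<open>C\<close> and \<open>C'\<close>: the common in-degree
      prefix sums cancel, and the minus sign before the out-degrees reverses the inequality. The
      bound \<open>i < m\<close> keeps every index inside the vectors.\<close>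
    moreover have "(\<Sum>k\<le>i. imbalances A $ k) = (\<Sum>k\<le>i. in_degrees A $ k) - (\<Sum>k\<le>i. out_degrees A $ k)"
      if "dim_row A = m" for A
      unfolding sum_subtractf[symmetric] using \<open>i < m\<close> that
      by (intro sum.cong) (auto simp: imbalances_def out_degrees_def)
    ultimately show ?thesis
      using dims assms(5) by (simp add: sum_subtractf)
  qed
  have "0 \<le> (\<Sum>k<m. ?d k * ?e k)"
    using assms(6) d_nonneg prefix by (intro antimono_weighted_sum_nonneg) auto
  then show ?thesis
    using assms(5) by (simp add: all_ones_square_sum[OF assms(1)] all_ones_square_sum[OF assms(2)]
        right_diff_distrib sum_subtractf)
qed

end
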